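(* Let $\Gamma$ be an environment, $e, e'$ evidence and $T$ a type of $\mathbf{F}_2^\mu$. If $\Gamma \vdash e : T$ and $e \leadsto_{h\tau o} e'$, then $\Gamma \vdash e' : T$.
   Context: System $\mathbf{F}_2^\mu$. Evidence $e ::= \alpha \mid \kappa \mid \lambda\alpha.e \mid e\,e' \mid \mu\alpha.e \mid e\,T \mid \lambda x.e$. Term kinds $K ::= * \mid * \Rightarrow K$. Types $T ::= F \mid x \mid \lambda x.T \mid \forall x{:}K.T \mid T\,T' \mid T \Rightarrow T'$. Environments $\Gamma ::= \cdot \mid \alpha:T,\Gamma \mid \kappa:T,\Gamma$. $\to_o$ is the compatible closure of $(\lambda x.T)\,T'\to_o[T'/x]T$; $\leftrightarrow_o^*$ its equivalence closure. Typing: (Var) $\Gamma\vdash\alpha:T$ / $\Gamma\vdash\kappa:T$ if declared in $\Gamma$; (App) from $\Gamma\vdash e_1:T'$ and $\Gamma\vdash e_2:T'\Rightarrow T$ infer $\Gamma\vdash e_2\,e_1:T$; (Lam) from $\Gamma,\alpha:T'\vdash e:T$ infer $\Gamma\vdash\lambda\alpha.e:T'\Rightarrow T$; (Mu) from $\Gamma,\alpha:T\vdash e:T$ infer $\Gamma\vdash\mu\alpha.e:T$; (Inst) from $\Gamma\vdash e:\forall x{:}K.T$ infer $\Gamma\vdash e\,T':[T'/x]T$; (Abs) from $\Gamma\vdash e:T$ and $x\notin\mathrm{FV}(\Gamma)$ infer $\Gamma\vdash\lambda x.e:\forall x{:}K.T$; (Conv) from $\Gamma\vdash e:T$ and $T\leftrightarrow_o^*T'$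 infer $\Gamma\vdash e:T'$. All types are required to be well-kinded in the kinding system of $\mathbf{F}_2^\mu$ (in particular a $\lambda$-abstracted type $\lambda x.T$ must use $x$ in $T$, and type variables bound by $\forall$ have kinds $K$). Head reduction: with $\mathcal{H} ::= \bullet \mid \mathcal{H}\,e \mid \lambda\alpha.\mathcal{H} \mid \lambda x.\mathcal{H}$ and $\mathcal{C} ::= \bullet \mid \mathcal{C}\,e \mid \mathcal{C}\,T \mid \lambda\alpha.\mathcal{C} \mid \lambda x.\mathcal{C} \mid e\,\mathcal{C} \mid \mu\alpha.\mathcal{C}$, define $\mathcal{H}[\mu\alpha.e]\leadsto_h\mathcal{H}[[\mu\alpha.e/\alpha]e]$, $\mathcal{H}[(\lambda\alpha.e)\,e']\leadsto_h\mathcal{H}[[e'/\alpha]e]$, $\mathcal{C}[(\lambda x.e)\,T]\leadsto_\tau\mathcal{C}[[T/x]e]$, $\mathcal{C}[T]\leadsto_o\mathcal{C}[T']$ if $T\to_o T'$; $\leadsto_{h\tau o}=\leadsto_h\cup\leadsto_\tau\cup\leadsto_o$. *)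

theory Defs
  imports Main
begin

(*
  Evidence variables (alpha) and type variables (x) are two independent families of de Bruijn
  indices, so terms are taken modulo renaming of bound variables.  Evidence constants (kappa) are
  drawn from 'c and type constants (F) from 'f.
*)

datatype tkind = Star | SArr tkind

datatype 'f ty =
    TCon 'f
  | TVar nat
  | TLam "'f ty"
  | TAll tkind "'f ty"
  | TApp "'f ty" "'f ty"
  | TArr "'f ty" "'f ty"

datatype ('f, 'c) evid =
    EVar nat
  | ECon 'c
  | ELam "('f, 'c) evid"
  | EApp "('f, 'c) evid" "('f, 'c) evid"
  | EMu "('f, 'c) evid"
  | ETApp "('f, 'c) evid" "'f ty"
  | ETLam "('f, 'c) evid"

primrec fv :: "'f ty \<Rightarrow> nat set" where
  "fv (TCon F) = {}"
| "fv (TVar i) = {i}"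
| "fv (TLam T) = {i. Suc i \<in> fv T}"
| "fv (TAll K T) = {i. Suc i \<in> fv T}"
| "fv (TApp T U) = fv T \<union> fv U"
| "fv (TArr T U) = fv T \<union> fv U"

primrec lift_ty :: "'f ty \<Rightarrow> nat \<Rightarrow> 'f ty" where
  "lift_ty (TCon F) k = TCon F"
| "lift_ty (TVar i) k = (if i < k then TVar i else TVar (Suc i))"
| "lift_ty (TLam T) k = TLam (lift_ty T (Suc k))"
| "lift_ty (TAll K T) k = TAll K (lift_ty T (Suc k))"
| "lift_ty (TApp T U) k = TApp (lift_ty T k) (lift_ty U k)"
| "lift_ty (TArr T U) k = TArr (lift_ty T k) (lift_ty U k)"

(* subst_ty T S k replaces index k by S and, since the binder of k disappears, decrements the
   indices above k. The substitutions on evidence below follow the same convention. *)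
primrec subst_ty :: "'f ty \<Rightarrow> 'f ty \<Rightarrow> nat \<Rightarrow> 'f ty" where
  "subst_ty (TCon F) S k = TCon F"
| "subst_ty (TVar i) S k = (if k < i then TVar (i - 1) else if i = k then S else TVar i)"
| "subst_ty (TLam T) S k = TLam (subst_ty T (lift_ty S 0) (Suc k))"
| "subst_ty (TAll K T) S k = TAll K (subst_ty T (lift_ty S 0) (Suc k))"
| "subst_ty (TApp T U) S k = TApp (subst_ty T S k) (subst_ty U S k)"
| "subst_ty (TArr T U) S k = TArr (subst_ty T S k) (subst_ty U S k)"

(* lift_ev and subst_ev act on the evidence variables of evidence,
   lift_ev_ty and subst_ev_ty on its type variables. *)
primrec lift_ev :: "('f, 'c) evid \<Rightarrow> nat \<Rightarrow> ('f, 'c) evid" where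
  "lift_ev (EVar i) k = (if i < k then EVar i else EVar (Suc i))"
| "lift_ev (ECon c) k = ECon c"
| "lift_ev (ELam e) k = ELam (lift_ev e (Suc k))"
| "lift_ev (EApp e e') k = EApp (lift_ev e k) (lift_ev e' k)"
| "lift_ev (EMu e) k = EMu (lift_ev e (Suc k))"
| "lift_ev (ETApp e T) k = ETApp (lift_ev e k) T"
| "lift_ev (ETLam e) k = ETLam (lift_ev e k)"

primrec lift_ev_ty :: "('f, 'c) evid \<Rightarrow> nat \<Rightarrow> ('f, 'c) evid" where
  "lift_ev_ty (EVar i) k = EVar i"
| "lift_ev_ty (ECon c) k = ECon c"
| "lift_ev_ty (ELam e) k = ELam (lift_ev_ty e k)"
| "lift_ev_ty (EApp e e') k = EApp (lift_ev_ty e k) (lift_ev_ty e' k)"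
| "lift_ev_ty (EMu e) k = EMu (lift_ev_ty e k)"
| "lift_ev_ty (ETApp e T) k = ETApp (lift_ev_ty e k) (lift_ty T k)"
| "lift_ev_ty (ETLam e) k = ETLam (lift_ev_ty e (Suc k))"

primrec subst_ev :: "('f, 'c) evid \<Rightarrow> ('f, 'c) evid \<Rightarrow> nat \<Rightarrow> ('f, 'c) evid" where
  "subst_ev (EVar i) s k = (if k < i then EVar (i - 1) else if i = k then s else EVar i)"
| "subst_ev (ECon c) s k = ECon c"
| "subst_ev (ELam e) s k = ELam (subst_ev e (lift_ev s 0) (Suc k))"
| "subst_ev (EApp e e') s k = EApp (subst_ev e s k) (subst_ev e' s k)"
| "subst_ev (EMu e) s k = EMu (subst_ev e (lift_ev s 0) (Suc k))"
| "subst_ev (ETApp e T) s k = ETApp (subst_ev e s k) T"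
| "subst_ev (ETLam e) s k = ETLam (subst_ev e (lift_ev_ty s 0) k)"

primrec subst_ev_ty :: "('f, 'c) evid \<Rightarrow> 'f ty \<Rightarrow> nat \<Rightarrow> ('f, 'c) evid" where
  "subst_ev_ty (EVar i) S k = EVar i"
| "subst_ev_ty (ECon c) S k = ECon c"
| "subst_ev_ty (ELam e) S k = ELam (subst_ev_ty e S k)"
| "subst_ev_ty (EApp e e') S k = EApp (subst_ev_ty e S k) (subst_ev_ty e' S k)"
| "subst_ev_ty (EMu e) S k = EMu (subst_ev_ty e S k)"
| "subst_ev_ty (ETApp e T) S k = ETApp (subst_ev_ty e S k) (subst_ty T S k)"
| "subst_ev_ty (ETLam e) S k = ETLam (subst_ev_ty e (lift_ty S 0) (Suc k))"

inductive ty_red :: "'f ty \<Rightarrow> 'f ty \<Rightarrow> bool" (infix \<open>\<rightarrow>\<^sub>o\<close> 50) where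
  beta: "TApp (TLam T) T' \<rightarrow>\<^sub>o subst_ty T T' 0"
| lam: "T \<rightarrow>\<^sub>o T' \<Longrightarrow> TLam T \<rightarrow>\<^sub>o TLam T'"
| all: "T \<rightarrow>\<^sub>o T' \<Longrightarrow> TAll K T \<rightarrow>\<^sub>o TAll K T'"
| appL: "T \<rightarrow>\<^sub>o T' \<Longrightarrow> TApp T U \<rightarrow>\<^sub>o TApp T' U"
| appR: "U \<rightarrow>\<^sub>o U' \<Longrightarrow> TApp T U \<rightarrow>\<^sub>o TApp T U'"
| arrL: "T \<rightarrow>\<^sub>o T' \<Longrightarrow> TArr T U \<rightarrow>\<^sub>o TArr T' U"
| arrR: "U \<rightarrow>\<^sub>o U' \<Longrightarrow> TArr T U \<rightarrow>\<^sub>o TArr T U'"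

abbreviation ty_conv :: "'f ty \<Rightarrow> 'f ty \<Rightarrow> bool" (infix \<open>\<leftrightarrow>\<^sub>o\<^sup>*\<close> 50) where
  "T \<leftrightarrow>\<^sub>o\<^sup>* T' \<equiv> equivclp ty_red T T'"

(*
  Kinds are the term kinds K together with the kind o of the remaining proper types (implications
  and quantified types).  The types that classify evidence are those of kind * or o; quantifiers
  range over term kinds only.  Sigma assigns kinds to the type constants, and the list Delta assigns
  kinds to the free type variables.
*)
datatype kind = Omicron | TK tkind

inductive kinding :: "('f \<Rightarrow> tkind) \<Rightarrow> tkind list \<Rightarrow> 'f ty \<Rightarrow> kind \<Rightarrow> bool"
  (\<open>_, _ \<turnstile>\<^sub>k _ \<Colon> _\<close> [51, 51, 51, 51] 50) for \<Sigma> where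
  con: "\<Sigma>, \<Delta> \<turnstile>\<^sub>k TCon F \<Colon> TK (\<Sigma> F)"
| var: "i < length \<Delta> \<Longrightarrow> \<Sigma>, \<Delta> \<turnstile>\<^sub>k TVar i \<Colon> TK (\<Delta> ! i)"
| lam: "\<Sigma>, Star # \<Delta> \<turnstile>\<^sub>k T \<Colon> TK K \<Longrightarrow> 0 \<in> fv T \<Longrightarrow> \<Sigma>, \<Delta> \<turnstile>\<^sub>k TLam T \<Colon> TK (SArr K)"
| app: "\<Sigma>, \<Delta> \<turnstile>\<^sub>k T \<Colon> TK (SArr K) \<Longrightarrow> \<Sigma>, \<Delta> \<turnstile>\<^sub>k T' \<Colon> TK Star \<Longrightarrow> \<Sigma>, \<Delta> \<turnstile>\<^sub>k TApp T T' \<Colon> TK K"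
| all: "\<Sigma>, K # \<Delta> \<turnstile>\<^sub>k T \<Colon> k \<Longrightarrow> k \<in> {TK Star, Omicron} \<Longrightarrow> \<Sigma>, \<Delta> \<turnstile>\<^sub>k TAll K T \<Colon> Omicron"
| arr: "\<Sigma>, \<Delta> \<turnstile>\<^sub>k T \<Colon> k \<Longrightarrow> k \<in> {TK Star, Omicron} \<Longrightarrow> \<Sigma>, \<Delta> \<turnstile>\<^sub>k T' \<Colon> k' \<Longrightarrow> k' \<in> {TK Star, Omicron}
    \<Longrightarrow> \<Sigma>, \<Delta> \<turnstile>\<^sub>k TArr T T' \<Colon> Omicron"

definition proper_ty :: "('f \<Rightarrow> tkind) \<Rightarrow> tkind list \<Rightarrow> 'f ty \<Rightarrow> bool" where
  "proper_ty \<Sigma> \<Delta> T \<longleftrightarrow> \<Sigma>, \<Delta> \<turnstile>\<^sub>k T \<Colon> TK Star \<or> \<Sigma>, \<Delta> \<turnstile>\<^sub>k T \<Colon> Omicron"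

datatype ('f, 'c) decl =
    VarDecl (decl_ty: "'f ty")
  | ConDecl 'c (decl_ty: "'f ty")

type_synonym ('f, 'c) env = "('f, 'c) decl list"

(* Evidence variable i refers to the i-th variable declaration, constant declarations being
   skipped. *)
fun var_tys :: "('f, 'c) env \<Rightarrow> 'f ty list" where
  "var_tys [] = []"
| "var_tys (VarDecl T # \<Gamma>) = T # var_tys \<Gamma>"
| "var_tys (ConDecl c T # \<Gamma>) = var_tys \<Gamma>"

fun lift_decl :: "('f, 'c) decl \<Rightarrow> ('f, 'c) decl" where
  "lift_decl (VarDecl T) = VarDecl (lift_ty T 0)"
| "lift_decl (ConDecl c T) = ConDecl c (lift_ty T 0)"

definition wf_env :: "('f \<Rightarrow> tkind) \<Rightarrow> tkind list \<Rightarrow> ('f, 'c) env \<Rightarrow> bool" where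
  "wf_env \<Sigma> \<Delta> \<Gamma> \<longleftrightarrow> (\<forall>d \<in> set \<Gamma>. proper_ty \<Sigma> \<Delta> (decl_ty d))"

(*
  The premises wf_env, proper_ty and kinding ensure that all types in a derivation are well-kinded;
  for the types not constrained by a premise this is inherited from the subderivations.
  In rule Abs the bound type variable is index 0 of the premise; lifting the environment expresses
  that it does not occur free there.
*)
inductive typing ::
  "('f \<Rightarrow> tkind) \<Rightarrow> tkind list \<Rightarrow> ('f, 'c) env \<Rightarrow> ('f, 'c) evid \<Rightarrow> 'f ty \<Rightarrow> bool"
  (\<open>_, _, _ \<turnstile> _ \<Colon> _\<close> [51, 51, 51, 51, 51] 50) for \<Sigma> where
  Var: "wf_env \<Sigma> \<Delta> \<Gamma> \<Longrightarrow> i < length (var_tys \<Gamma>) \<Longrightarrow> \<Sigma>, \<Delta>, \<Gamma> \<turnstile> EVar i \<Colon> var_tys \<Gamma> ! i"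
| Con: "wf_env \<Sigma> \<Delta> \<Gamma> \<Longrightarrow> ConDecl c T \<in> set \<Gamma> \<Longrightarrow> \<Sigma>, \<Delta>, \<Gamma> \<turnstile> ECon c \<Colon> T"
| App: "\<Sigma>, \<Delta>, \<Gamma> \<turnstile> e1 \<Colon> T' \<Longrightarrow> \<Sigma>, \<Delta>, \<Gamma> \<turnstile> e2 \<Colon> TArr T' T \<Longrightarrow> \<Sigma>, \<Delta>, \<Gamma> \<turnstile> EApp e2 e1 \<Colon> T"
| Lam: "\<Sigma>, \<Delta>, VarDecl T' # \<Gamma> \<turnstile> e \<Colon> T \<Longrightarrow> \<Sigma>, \<Delta>, \<Gamma> \<turnstile> ELam e \<Colon> TArr T' T"
| Mu: "\<Sigma>, \<Delta>, VarDecl T # \<Gamma> \<turnstile> e \<Colon> T \<Longrightarrow> \<Sigma>, \<Delta>, \<Gamma> \<turnstile> EMu e \<Colon> T"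
| Inst: "\<Sigma>, \<Delta>, \<Gamma> \<turnstile> e \<Colon> TAll K T \<Longrightarrow> \<Sigma>, \<Delta> \<turnstile>\<^sub>k T' \<Colon> TK K \<Longrightarrow> \<Sigma>, \<Delta>, \<Gamma> \<turnstile> ETApp e T' \<Colon> subst_ty T T' 0"
| Abs: "\<Sigma>, K # \<Delta>, map lift_decl \<Gamma> \<turnstile> e \<Colon> T \<Longrightarrow> \<Sigma>, \<Delta>, \<Gamma> \<turnstile> ETLam e \<Colon> TAll K T"
| Conv: "\<Sigma>, \<Delta>, \<Gamma> \<turnstile> e \<Colon> T \<Longrightarrow> T \<leftrightarrow>\<^sub>o\<^sup>* T' \<Longrightarrow> proper_ty \<Sigma> \<Delta> T' \<Longrightarrow> \<Sigma>, \<Delta>, \<Gamma> \<turnstile> e \<Colon> T'"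

datatype ('f, 'c) hctx =
    HHole
  | HApp "('f, 'c) hctx" "('f, 'c) evid"
  | HLam "('f, 'c) hctx"
  | HTLam "('f, 'c) hctx"

(* Plugging may capture variables of the filler, as usual for contexts. *)
primrec plugH :: "('f, 'c) hctx \<Rightarrow> ('f, 'c) evid \<Rightarrow> ('f, 'c) evid" where
  "plugH HHole s = s"
| "plugH (HApp H e) s = EApp (plugH H s) e"
| "plugH (HLam H) s = ELam (plugH H s)"
| "plugH (HTLam H) s = ETLam (plugH H s)"

datatype ('f, 'c) cctx =
    CHole
  | CAppL "('f, 'c) cctx" "('f, 'c) evid"
  | CTApp "('f, 'c) cctx" "'f ty"
  | CLam "('f, 'c) cctx"
  | CTLam "('f, 'c) cctx"
  | CAppR "('f, 'c) evid" "('f, 'c) cctx"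
  | CMu "('f, 'c) cctx"

primrec plugC :: "('f, 'c) cctx \<Rightarrow> ('f, 'c) evid \<Rightarrow> ('f, 'c) evid" where
  "plugC CHole s = s"
| "plugC (CAppL C e) s = EApp (plugC C s) e"
| "plugC (CTApp C T) s = ETApp (plugC C s) T"
| "plugC (CLam C) s = ELam (plugC C s)"
| "plugC (CTLam C) s = ETLam (plugC C s)"
| "plugC (CAppR e C) s = EApp e (plugC C s)"
| "plugC (CMu C) s = EMu (plugC C s)"

inductive red_h :: "('f, 'c) evid \<Rightarrow> ('f, 'c) evid \<Rightarrow> bool" (infix \<open>\<leadsto>\<^sub>h\<close> 50) where
  mu: "plugH H (EMu e) \<leadsto>\<^sub>h plugH H (subst_ev e (EMu e) 0)"
| beta: "plugH H (EApp (ELam e) e') \<leadsto>\<^sub>h plugH H (subst_ev e e' 0)"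

inductive red_tau :: "('f, 'c) evid \<Rightarrow> ('f, 'c) evid \<Rightarrow> bool" (infix \<open>\<leadsto>\<^sub>\<tau>\<close> 50) where
  "plugC C (ETApp (ETLam e) T) \<leadsto>\<^sub>\<tau> plugC C (subst_ev_ty e T 0)"

(* A context filled with a type T is evidence only if its hole is the argument of an application,
   that is, if the result is C[e T] for some C and e. *)
inductive red_o :: "('f, 'c) evid \<Rightarrow> ('f, 'c) evid \<Rightarrow> bool" (infix \<open>\<leadsto>\<^sub>o\<close> 50) where
  "T \<rightarrow>\<^sub>o T' \<Longrightarrow> plugC C (ETApp e T) \<leadsto>\<^sub>o plugC C (ETApp e T')"

definition red_hto :: "('f, 'c) evid \<Rightarrow> ('f, 'c) evid \<Rightarrow> bool" (infix \<open>\<leadsto>\<^sub>h\<^sub>\<tau>\<^sub>o\<close> 50) where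
  "e \<leadsto>\<^sub>h\<^sub>\<tau>\<^sub>o e' \<longleftrightarrow> e \<leadsto>\<^sub>h e' \<or> e \<leadsto>\<^sub>\<tau> e' \<or> e \<leadsto>\<^sub>o e'"

end

theory Submission
  imports Defs "HOL-Library.Confluence"
begin

text \<open>Parallel type reduction is confluent, by comparing each parallel step with the complete
  development of its source. Hence convertible implications have convertible components, and
  convertible quantified types have equal kinds and convertible bodies; no kinding of the
  intermediate types of a conversion is needed. Together with the inversion of typing up to
  conversion and the substitution lemmas for types and evidence, this gives subject reduction for
  the redexes. In a \<open>\<leadsto>\<^sub>o\<close> step the type argument keeps its kind, and the type of the instance changes
  only up to conversion. Every constructor of a context is inverted and retyped.\<close>

section \<open>Substitution on types\<close>

text \<open>A gap at \<open>k\<close> sits at \<open>Suc k\<close> once another gap has been opened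
  at or below it. The case \<open>i = 0\<close> is the one met under binders, where the substituted
  type is lifted.\<close>

lemma lift_ty_lift_ty: "i \<le> k \<Longrightarrow> lift_ty (lift_ty T i) (Suc k) = lift_ty (lift_ty T k) i"
  by (induction T arbitrary: i k) auto

lemma lift_ty_subst_ty_le:
  "j \<le> i \<Longrightarrow> lift_ty (subst_ty T S j) i = subst_ty (lift_ty T (Suc i)) (lift_ty S i) j"
  by (induction T arbitrary: i j S) (auto simp: lift_ty_lift_ty)

lemma lift_ty_subst_ty_ge:
  "i \<le> j \<Longrightarrow> lift_ty (subst_ty T S j) i = subst_ty (lift_ty T i) (lift_ty S i) (Suc j)"
  by (induction T arbitrary: i j S) (auto simp: lift_ty_lift_ty)

lemma subst_ty_lift_ty [simp]: "subst_ty (lift_ty T k) S k = T"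
  by (induction T arbitrary: k S) auto

text \<open>The substitution lemma for de Bruijn indices. At index \<open>Suc j\<close> of
  \<open>T\<close> it reduces to \<open>subst_ty_lift_ty\<close>; the case \<open>i = 0\<close>
  commutes a substitution with a beta contraction.\<close>

lemma subst_ty_subst_ty:
  "i \<le> j \<Longrightarrow> subst_ty (subst_ty T (lift_ty V i) (Suc j)) (subst_ty U V j) i
     = subst_ty (subst_ty T U i) V j"
  by (induction T arbitrary: i j U V)
    (auto simp: lift_ty_lift_ty[symmetric] lift_ty_subst_ty_ge)

lemma fv_lift_ty:
  "fv (lift_ty T k) = {i. i < k \<and> i \<in> fv T} \<union> {i. k < i \<and> i - 1 \<in> fv T}"
proof (induction T arbitrary: k)
  case (TLam T)
  show ?case by (auto simp: TLam)
next
  case (TAll K T)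
  show ?case by (auto simp: TAll)
qed auto

text \<open>An equation rather than an inclusion, because the occurrence condition on
  \<open>TLam\<close> must be carried through substitution and contraction.\<close>

lemma fv_subst_ty:
  "fv (subst_ty T S k) =
     {i. i < k \<and> i \<in> fv T} \<union> {i. k \<le> i \<and> Suc i \<in> fv T} \<union> (if k \<in> fv T then fv S else {})"
proof (induction T arbitrary: S k)
  case (TLam T)
  show ?case by (auto simp: TLam fv_lift_ty)
next
  case (TAll K T)
  show ?case by (auto simp: TAll fv_lift_ty)
qed (auto split: if_splits)

section \<open>Confluence of type reduction\<close>

text \<open>Parallel reduction in the style of Tait and Martin-Loef: any choice of redexes present
  in the source is contracted at once, so that copying an argument does not spoil the diamond
  property.\<close>

inductive ty_par :: "'f ty \<Rightarrow> 'f ty \<Rightarrow> bool" (infix \<open>\<Rrightarrow>\<close> 50) where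
  con: "TCon F \<Rrightarrow> TCon F"
| var: "TVar i \<Rrightarrow> TVar i"
| lam: "T \<Rrightarrow> T' \<Longrightarrow> TLam T \<Rrightarrow> TLam T'"
| all: "T \<Rrightarrow> T' \<Longrightarrow> TAll K T \<Rrightarrow> TAll K T'"
| app: "T \<Rrightarrow> T' \<Longrightarrow> U \<Rrightarrow> U' \<Longrightarrow> TApp T U \<Rrightarrow> TApp T' U'"
| arr: "T \<Rrightarrow> T' \<Longrightarrow> U \<Rrightarrow> U' \<Longrightarrow> TArr T U \<Rrightarrow> TArr T' U'"
| beta: "T \<Rrightarrow> T' \<Longrightarrow> U \<Rrightarrow> U' \<Longrightarrow> TApp (TLam T) U \<Rrightarrow> subst_ty T' U' 0"

inductive_cases ty_par_lamE: "TLam T \<Rrightarrow> U"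
inductive_cases ty_par_allE: "TAll K T \<Rrightarrow> U"
inductive_cases ty_par_arrE: "TArr T T' \<Rrightarrow> U"

lemma ty_par_refl [simp]: "T \<Rrightarrow> T"
  by (induction T) (auto intro: ty_par.intros)

lemma ty_par_lift_ty: "T \<Rrightarrow> T' \<Longrightarrow> lift_ty T k \<Rrightarrow> lift_ty T' k"
proof (induction arbitrary: k rule: ty_par.induct)
  case (beta T T' U U')
  then show ?case by (simp add: lift_ty_subst_ty_le ty_par.beta)
qed (auto intro: ty_par.intros)

lemma ty_par_subst_ty: "T \<Rrightarrow> T' \<Longrightarrow> S \<Rrightarrow> S' \<Longrightarrow> subst_ty T S k \<Rrightarrow> subst_ty T' S' k"
proof (induction arbitrary: S S' k rule: ty_par.induct)
  case (beta T T' U U')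
  then have "TApp (TLam (subst_ty T (lift_ty S 0) (Suc k))) (subst_ty U S k)
      \<Rrightarrow> subst_ty (subst_ty T' (lift_ty S' 0) (Suc k)) (subst_ty U' S' k) 0"
    by (intro ty_par.beta) (auto intro: ty_par_lift_ty)
  then show ?case by (simp add: subst_ty_subst_ty)
qed (auto simp: ty_par.intros ty_par_lift_ty)

text \<open>Takahashi's complete development: every redex present in the source is
  contracted.\<close>

fun ty_dev :: "'f ty \<Rightarrow> 'f ty" where
  "ty_dev (TCon F) = TCon F"
| "ty_dev (TVar i) = TVar i"
| "ty_dev (TLam T) = TLam (ty_dev T)"
| "ty_dev (TAll K T) = TAll K (ty_dev T)"
| "ty_dev (TApp (TLam T) U) = subst_ty (ty_dev T) (ty_dev U) 0"
| "ty_dev (TApp T U) = TApp (ty_dev T) (ty_dev U)"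
| "ty_dev (TArr T U) = TArr (ty_dev T) (ty_dev U)"

text \<open>The triangle property: the meeting point depends on \<open>T\<close> alone. Only
  \<open>app\<close> needs an argument, since it may keep a root redex that the development
  contracts.\<close>

lemma ty_par_ty_dev: "T \<Rrightarrow> T' \<Longrightarrow> T' \<Rrightarrow> ty_dev T"
proof (induction rule: ty_par.induct)
  case (app T T' U U')
  show ?case
  proof (cases "\<exists>T0. T = TLam T0")
    case True
    then obtain T0 where T: "T = TLam T0" by blast
    \<comment> \<open>An abstraction can only step to an abstraction, so the root redex is still
      there for \<open>ty_par.beta\<close>.\<close>
    with app.hyps obtain T0' where T': "T' = TLam T0'" by (auto elim: ty_par_lamE)
    have "T0' \<Rrightarrow> ty_dev T0" using app.IH(1) unfolding T T' by (auto elim: ty_par_lamE)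
    then show ?thesis using app.IH(2) unfolding T T' by (simp add: ty_par.beta)
  next
    case False
    then have "ty_dev (TApp T U) = TApp (ty_dev T) (ty_dev U)" by (cases T) auto
    then show ?thesis using app.IH by (simp add: ty_par.app)
  qed
qed (auto intro: ty_par.intros ty_par_subst_ty)

text \<open>Two parallel steps from one type meet in its development after one further step
  each.\<close>

lemma confluentp_ty_par: "confluentp ty_par"
  by (rule strong_confluentp_imp_confluentp, rule strong_confluentpI)
    (blast intro: ty_par_ty_dev)

lemma ty_red_imp_ty_par: "T \<rightarrow>\<^sub>o T' \<Longrightarrow> T \<Rrightarrow> T'"
  by (induction rule: ty_red.induct) (auto intro: ty_par.intros)

text \<open>Serves congruence, substitution, lifting and, with \<open>f\<close> the identity, change
  of relation. Images of a single step need only be convertible, as substitution is handled through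
  parallel steps.\<close>

lemma equivclp_map:
  assumes "equivclp r x y" and "\<And>x y. r x y \<Longrightarrow> equivclp s (f x) (f y)"
  shows "equivclp s (f x) (f y)"
  using assms(1)
  by (induction rule: equivclp_induct)
    (blast intro: equivclp_refl equivclp_trans equivclp_sym assms(2))+

text \<open>The Church-Rosser property. The common reduct is reached by parallel steps, whose effect
  below a fixed outermost constructor is easy to follow.\<close>

lemma ty_conv_common_reduct:
  assumes "T \<leftrightarrow>\<^sub>o\<^sup>* U"
  obtains V where "ty_par\<^sup>*\<^sup>* T V" "ty_par\<^sup>*\<^sup>* U V"
proof -
  have "equivclp ty_par T U"
    using equivclp_map[OF assms, of ty_par "\<lambda>x. x"] ty_red_imp_ty_par by blast
  then have "(ty_par\<^sup>*\<^sup>* OO ty_par\<inverse>\<inverse>\<^sup>*\<^sup>*) T U"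
    by (simp add: semiconfluentp_equivclp confluentp_imp_semiconfluentp confluentp_ty_par)
  then show ?thesis using that by (auto simp: rtranclp_conversep)
qed

section \<open>Conversion as a congruence containing parallel reduction\<close>

lemma ty_conv_lam: "T \<leftrightarrow>\<^sub>o\<^sup>* T' \<Longrightarrow> TLam T \<leftrightarrow>\<^sub>o\<^sup>* TLam T'"
  by (erule equivclp_map) (blast intro: ty_red.intros)

lemma ty_conv_all: "T \<leftrightarrow>\<^sub>o\<^sup>* T' \<Longrightarrow> TAll K T \<leftrightarrow>\<^sub>o\<^sup>* TAll K T'"
  by (erule equivclp_map) (blast intro: ty_red.intros)

lemma ty_conv_app:
  assumes "T \<leftrightarrow>\<^sub>o\<^sup>* T'" "U \<leftrightarrow>\<^sub>o\<^sup>* U'"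
  shows "TApp T U \<leftrightarrow>\<^sub>o\<^sup>* TApp T' U'"
proof -
  have "TApp T U \<leftrightarrow>\<^sub>o\<^sup>* TApp T' U"
    by (rule equivclp_map[OF assms(1), where f = "\<lambda>T. TApp T U"]) (blast intro: ty_red.intros)
  also have "\<dots> \<leftrightarrow>\<^sub>o\<^sup>* TApp T' U'"
    by (rule equivclp_map[OF assms(2)]) (blast intro: ty_red.intros)
  finally show ?thesis .
qed

lemma ty_conv_arr:
  assumes "T \<leftrightarrow>\<^sub>o\<^sup>* T'" "U \<leftrightarrow>\<^sub>o\<^sup>* U'"
  shows "TArr T U \<leftrightarrow>\<^sub>o\<^sup>* TArr T' U'"
proof -
  have "TArr T U \<leftrightarrow>\<^sub>o\<^sup>* TArr T' U"
    by (rule equivclp_map[OF assms(1), where f = "\<lambda>T. TArr T U"]) (blast intro: ty_red.intros)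
  also have "\<dots> \<leftrightarrow>\<^sub>o\<^sup>* TArr T' U'"
    by (rule equivclp_map[OF assms(2)]) (blast intro: ty_red.intros)
  finally show ?thesis .
qed

lemma ty_par_imp_ty_conv: "T \<Rrightarrow> T' \<Longrightarrow> T \<leftrightarrow>\<^sub>o\<^sup>* T'"
proof (induction rule: ty_par.induct)
  case (beta T T' U U')
  then have "TApp (TLam T) U \<leftrightarrow>\<^sub>o\<^sup>* TApp (TLam T') U'" by (intro ty_conv_app ty_conv_lam)
  then show ?case by (rule equivclp_trans) (blast intro: ty_red.beta)
qed (auto intro: ty_conv_lam ty_conv_all ty_conv_app ty_conv_arr)

text \<open>An implication is never itself a redex, so all steps take place inside its
  components.\<close>

lemma ty_par_rtranclp_arr:
  assumes "ty_par\<^sup>*\<^sup>* (TArr A B) V"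
  shows "\<exists>A' B'. V = TArr A' B' \<and> A \<leftrightarrow>\<^sub>o\<^sup>* A' \<and> B \<leftrightarrow>\<^sub>o\<^sup>* B'"
  using assms
  by (induction rule: rtranclp_induct)
    (blast elim: ty_par_arrE dest: ty_par_imp_ty_conv intro: equivclp_refl equivclp_trans)+

lemma ty_par_rtranclp_all:
  assumes "ty_par\<^sup>*\<^sup>* (TAll K A) V"
  shows "\<exists>A'. V = TAll K A' \<and> A \<leftrightarrow>\<^sub>o\<^sup>* A'"
  using assms
  by (induction rule: rtranclp_induct)
    (blast elim: ty_par_allE dest: ty_par_imp_ty_conv intro: equivclp_refl equivclp_trans)+

text \<open>The conversion may pass through types of other shapes; the common reduct avoids them,
  being an implication with components convertible to those of both sides.\<close>

lemma ty_conv_arrD: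
  assumes "TArr A B \<leftrightarrow>\<^sub>o\<^sup>* TArr A' B'"
  shows "A \<leftrightarrow>\<^sub>o\<^sup>* A'" "B \<leftrightarrow>\<^sub>o\<^sup>* B'"
proof -
  from assms obtain V where "ty_par\<^sup>*\<^sup>* (TArr A B) V" "ty_par\<^sup>*\<^sup>* (TArr A' B') V"
    by (rule ty_conv_common_reduct)
  from this[THEN ty_par_rtranclp_arr] show "A \<leftrightarrow>\<^sub>o\<^sup>* A'" "B \<leftrightarrow>\<^sub>o\<^sup>* B'"
    by (auto intro: equivclp_trans equivclp_sym)
qed

lemma ty_conv_allD:
  assumes "TAll K A \<leftrightarrow>\<^sub>o\<^sup>* TAll K' A'"
  shows "K = K'" "A \<leftrightarrow>\<^sub>o\<^sup>* A'"
proof -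
  from assms obtain V where "ty_par\<^sup>*\<^sup>* (TAll K A) V" "ty_par\<^sup>*\<^sup>* (TAll K' A') V"
    by (rule ty_conv_common_reduct)
  from this[THEN ty_par_rtranclp_all] show "K = K'" "A \<leftrightarrow>\<^sub>o\<^sup>* A'"
    by (auto intro: equivclp_trans equivclp_sym)
qed

section \<open>Stability of conversion under substitution and lifting\<close>

lemma ty_conv_subst_ty: "T \<leftrightarrow>\<^sub>o\<^sup>* T' \<Longrightarrow> subst_ty T S k \<leftrightarrow>\<^sub>o\<^sup>* subst_ty T' S k"
  by (erule equivclp_map)
    (intro ty_par_imp_ty_conv ty_par_subst_ty ty_red_imp_ty_par ty_par_refl)

text \<open>The step in \<open>S\<close> is repeated at every occurrence of index \<open>k\<close>,
  possibly at none; one parallel step covers them all.\<close>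

lemma ty_conv_subst_ty_arg: "S \<rightarrow>\<^sub>o S' \<Longrightarrow> subst_ty T S k \<leftrightarrow>\<^sub>o\<^sup>* subst_ty T S' k"
  by (intro ty_par_imp_ty_conv ty_par_subst_ty ty_red_imp_ty_par ty_par_refl)

lemma ty_conv_lift_ty: "T \<leftrightarrow>\<^sub>o\<^sup>* T' \<Longrightarrow> lift_ty T k \<leftrightarrow>\<^sub>o\<^sup>* lift_ty T' k"
  by (erule equivclp_map) (intro ty_par_imp_ty_conv ty_par_lift_ty ty_red_imp_ty_par)

section \<open>Kinding\<close>

inductive_simps kinding_simps:
  "\<Sigma>, \<Delta> \<turnstile>\<^sub>k TCon F \<Colon> k"
  "\<Sigma>, \<Delta> \<turnstile>\<^sub>k TVar i \<Colon> k"
  "\<Sigma>, \<Delta> \<turnstile>\<^sub>k TLam T \<Colon> k"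
  "\<Sigma>, \<Delta> \<turnstile>\<^sub>k TAll K T \<Colon> k"
  "\<Sigma>, \<Delta> \<turnstile>\<^sub>k TApp T U \<Colon> k"
  "\<Sigma>, \<Delta> \<turnstile>\<^sub>k TArr T U \<Colon> k"

text \<open>\<open>\<Delta>\<^sub>1\<close> collects the kinds of the binders crossed. The direction
  removing the lift lets well-formedness of environments descend through rule
  \<open>Abs\<close>.\<close>

lemma kinding_lift_ty_iff:
  "\<Sigma>, \<Delta>\<^sub>1 @ K # \<Delta>\<^sub>2 \<turnstile>\<^sub>k lift_ty T (length \<Delta>\<^sub>1) \<Colon> k \<longleftrightarrow> \<Sigma>, \<Delta>\<^sub>1 @ \<Delta>\<^sub>2 \<turnstile>\<^sub>k T \<Colon> k"
proof (induction T arbitrary: \<Delta>\<^sub>1 k)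
  case (TVar i)
  then show ?case by (auto simp: kinding_simps nth_append)
next
  case (TLam T)
  show ?case using TLam[of "Star # \<Delta>\<^sub>1"] by (simp add: kinding_simps fv_lift_ty)
next
  case (TAll K' T)
  show ?case using TAll[of "K' # \<Delta>\<^sub>1"] by (simp add: kinding_simps)
qed (simp_all add: kinding_simps)

lemma kinding_lift_ty: "\<Sigma>, \<Delta> \<turnstile>\<^sub>k T \<Colon> k \<Longrightarrow> \<Sigma>, K # \<Delta> \<turnstile>\<^sub>k lift_ty T 0 \<Colon> k"
  using kinding_lift_ty_iff[of \<Sigma> "[]" K \<Delta> T k] by simp

lemma kinding_subst_ty:
  assumes "\<Sigma>, \<Delta>\<^sub>1 @ K # \<Delta>\<^sub>2 \<turnstile>\<^sub>k T \<Colon> k" and "\<Sigma>, \<Delta>\<^sub>1 @ \<Delta>\<^sub>2 \<turnstile>\<^sub>k S \<Colon> TK K"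
  shows "\<Sigma>, \<Delta>\<^sub>1 @ \<Delta>\<^sub>2 \<turnstile>\<^sub>k subst_ty T S (length \<Delta>\<^sub>1) \<Colon> k"
  using assms
proof (induction T arbitrary: \<Delta>\<^sub>1 S k)
  case (TVar i)
  then show ?case
    by (cases "i \<le> length \<Delta>\<^sub>1") (auto simp: kinding_simps nth_append nth_Cons' split: if_splits)
next
  case (TLam T)
  \<comment> \<open>Substitution under the binder acts above index 0, so \<open>fv_subst_ty\<close>
    keeps 0 among the free variables.\<close>
  then show ?case using TLam.IH[of "Star # \<Delta>\<^sub>1"]
    by (auto simp: kinding_simps fv_subst_ty kinding_lift_ty)
next
  case (TAll K' T)
  have "\<Sigma>, K' # \<Delta>\<^sub>1 @ \<Delta>\<^sub>2 \<turnstile>\<^sub>k subst_ty T (lift_ty S 0) (Suc (length \<Delta>\<^sub>1)) \<Colon> k"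
    if "\<Sigma>, K' # \<Delta>\<^sub>1 @ K # \<Delta>\<^sub>2 \<turnstile>\<^sub>k T \<Colon> k" for k
    using TAll.IH[of "K' # \<Delta>\<^sub>1" k "lift_ty S 0"] TAll.prems(2) that by (simp add: kinding_lift_ty)
  then show ?case using TAll.prems(1) by (auto simp: kinding_simps)
next
  case (TArr T U)
  then show ?case using TArr.IH[OF _ TArr.prems(2)] by (auto simp: kinding_simps) blast+
qed (auto simp: kinding_simps)

text \<open>Since a bound variable must occur in its scope, reduction neither erases nor creates free
  variables; this is what makes the occurrence condition for \<open>TLam\<close> stable under reduction.\<close>

lemma fv_ty_red: "T \<rightarrow>\<^sub>o T' \<Longrightarrow> \<Sigma>, \<Delta> \<turnstile>\<^sub>k T \<Colon> k \<Longrightarrow> fv T' = fv T"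
  by (induction arbitrary: \<Delta> k rule: ty_red.induct) (fastforce simp: kinding_simps fv_subst_ty)+

lemma kinding_ty_red: "T \<rightarrow>\<^sub>o T' \<Longrightarrow> \<Sigma>, \<Delta> \<turnstile>\<^sub>k T \<Colon> k \<Longrightarrow> \<Sigma>, \<Delta> \<turnstile>\<^sub>k T' \<Colon> k"
proof (induction arbitrary: \<Delta> k rule: ty_red.induct)
  case (beta T T')
  then show ?case using kinding_subst_ty[of \<Sigma> "[]" Star \<Delta> T k T'] by (auto simp: kinding_simps)
qed (auto simp: kinding_simps fv_ty_red)

lemma proper_ty_lift_ty_iff:
  "proper_ty \<Sigma> (\<Delta>\<^sub>1 @ K # \<Delta>\<^sub>2) (lift_ty T (length \<Delta>\<^sub>1)) \<longleftrightarrow> proper_ty \<Sigma> (\<Delta>\<^sub>1 @ \<Delta>\<^sub>2) T"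
  by (simp add: proper_ty_def kinding_lift_ty_iff)

lemma proper_ty_subst_ty:
  "proper_ty \<Sigma> (\<Delta>\<^sub>1 @ K # \<Delta>\<^sub>2) T \<Longrightarrow> \<Sigma>, \<Delta>\<^sub>1 @ \<Delta>\<^sub>2 \<turnstile>\<^sub>k S \<Colon> TK K
    \<Longrightarrow> proper_ty \<Sigma> (\<Delta>\<^sub>1 @ \<Delta>\<^sub>2) (subst_ty T S (length \<Delta>\<^sub>1))"
  unfolding proper_ty_def by (blast intro: kinding_subst_ty)

lemma proper_ty_arr: "proper_ty \<Sigma> \<Delta> (TArr A B) \<longleftrightarrow> proper_ty \<Sigma> \<Delta> A \<and> proper_ty \<Sigma> \<Delta> B"
  by (auto simp: proper_ty_def kinding_simps)

lemma proper_ty_all: "proper_ty \<Sigma> \<Delta> (TAll K A) \<longleftrightarrow> proper_ty \<Sigma> (K # \<Delta>) A"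
  by (auto simp: proper_ty_def kinding_simps)

section \<open>Environments\<close>

text \<open>Lifting and substitution in environments become instances of one map,
  \<open>lift_decl\<close> among them.\<close>

primrec map_decl_ty :: "('f ty \<Rightarrow> 'f ty) \<Rightarrow> ('f, 'c) decl \<Rightarrow> ('f, 'c) decl" where
  "map_decl_ty f (VarDecl T) = VarDecl (f T)"
| "map_decl_ty f (ConDecl c T) = ConDecl c (f T)"

lemma lift_decl_eq_map_decl_ty: "lift_decl = map_decl_ty (\<lambda>T. lift_ty T 0)"
proof
  show "lift_decl d = map_decl_ty (\<lambda>T. lift_ty T 0) d" for d :: "('f, 'c) decl"
    by (cases d) auto
qed

lemma decl_ty_map_decl_ty [simp]: "decl_ty (map_decl_ty f d) = f (decl_ty d)"
  by (cases d) auto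

lemma map_decl_ty_compose: "map_decl_ty f (map_decl_ty g d) = map_decl_ty (\<lambda>T. f (g T)) d"
  by (cases d) auto

lemma var_tys_map_decl_ty [simp]: "var_tys (map (map_decl_ty f) \<Gamma>) = map f (var_tys \<Gamma>)"
  by (induction \<Gamma> rule: var_tys.induct) auto

lemma var_tys_append [simp]: "var_tys (\<Gamma>\<^sub>1 @ \<Gamma>\<^sub>2) = var_tys \<Gamma>\<^sub>1 @ var_tys \<Gamma>\<^sub>2"
  by (induction \<Gamma>\<^sub>1 rule: var_tys.induct) auto

lemma ConDecl_map_decl_ty:
  "ConDecl c T \<in> set \<Gamma> \<Longrightarrow> ConDecl c (f T) \<in> set (map (map_decl_ty f) \<Gamma>)"
  by (force simp: image_iff)

lemma var_tys_in_env: "T \<in> set (var_tys \<Gamma>) \<Longrightarrow> VarDecl T \<in> set \<Gamma>"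
  by (induction \<Gamma> rule: var_tys.induct) auto

lemma map_lift_decl_lift_ty:
  "map (map_decl_ty (\<lambda>T. lift_ty T (Suc k))) (map lift_decl \<Gamma>)
     = map lift_decl (map (map_decl_ty (\<lambda>T. lift_ty T k)) \<Gamma>)"
  by (simp add: lift_decl_eq_map_decl_ty map_decl_ty_compose lift_ty_lift_ty)

lemma map_lift_decl_subst_ty:
  "map (map_decl_ty (\<lambda>T. subst_ty T (lift_ty S 0) (Suc k))) (map lift_decl \<Gamma>)
     = map lift_decl (map (map_decl_ty (\<lambda>T. subst_ty T S k)) \<Gamma>)"
  by (simp add: lift_decl_eq_map_decl_ty map_decl_ty_compose lift_ty_subst_ty_ge)

text \<open>Undoes the lifting of the environment in rule \<open>Abs\<close> when the bound type
  variable is instantiated.\<close>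

lemma map_subst_ty_lift_decl [simp]:
  "map (map_decl_ty (\<lambda>T. subst_ty T S 0)) (map lift_decl \<Gamma>) = \<Gamma>"
proof -
  have "map_decl_ty (\<lambda>T. subst_ty T S 0) (lift_decl d) = d" for d :: "('a, 'b) decl"
    by (cases d) auto
  then show ?thesis by (simp add: map_idI)
qed

lemma wf_env_Cons [simp]: "wf_env \<Sigma> \<Delta> (d # \<Gamma>) \<longleftrightarrow> proper_ty \<Sigma> \<Delta> (decl_ty d) \<and> wf_env \<Sigma> \<Delta> \<Gamma>"
  by (auto simp: wf_env_def)

lemma wf_env_append [simp]: "wf_env \<Sigma> \<Delta> (\<Gamma>\<^sub>1 @ \<Gamma>\<^sub>2) \<longleftrightarrow> wf_env \<Sigma> \<Delta> \<Gamma>\<^sub>1 \<and> wf_env \<Sigma> \<Delta> \<Gamma>\<^sub>2"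
  by (auto simp: wf_env_def)

lemma wf_env_lift_decl [simp]: "wf_env \<Sigma> (K # \<Delta>) (map lift_decl \<Gamma>) \<longleftrightarrow> wf_env \<Sigma> \<Delta> \<Gamma>"
  using proper_ty_lift_ty_iff[of \<Sigma> "[]" K \<Delta>]
  by (simp add: wf_env_def lift_decl_eq_map_decl_ty)

lemma wf_env_lift_ty:
  "wf_env \<Sigma> (\<Delta>\<^sub>1 @ \<Delta>\<^sub>2) \<Gamma>
    \<Longrightarrow> wf_env \<Sigma> (\<Delta>\<^sub>1 @ K # \<Delta>\<^sub>2) (map (map_decl_ty (\<lambda>T. lift_ty T (length \<Delta>\<^sub>1))) \<Gamma>)"
  by (simp add: wf_env_def proper_ty_lift_ty_iff)

lemma wf_env_subst_ty:
  "wf_env \<Sigma> (\<Delta>\<^sub>1 @ K # \<Delta>\<^sub>2) \<Gamma> \<Longrightarrow> \<Sigma>, \<Delta>\<^sub>1 @ \<Delta>\<^sub>2 \<turnstile>\<^sub>k S \<Colon> TK K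
    \<Longrightarrow> wf_env \<Sigma> (\<Delta>\<^sub>1 @ \<Delta>\<^sub>2) (map (map_decl_ty (\<lambda>T. subst_ty T S (length \<Delta>\<^sub>1))) \<Gamma>)"
  by (auto simp: wf_env_def intro: proper_ty_subst_ty)

section \<open>Typing\<close>

text \<open>Supplies the \<open>proper_ty\<close> premise of \<open>Conv\<close> wherever a type is
  converted.\<close>

lemma typing_regular: "\<Sigma>, \<Delta>, \<Gamma> \<turnstile> e \<Colon> T \<Longrightarrow> wf_env \<Sigma> \<Delta> \<Gamma> \<and> proper_ty \<Sigma> \<Delta> T"
proof (induction rule: typing.induct)
  case (Var \<Delta> \<Gamma> i)
  then show ?case using var_tys_in_env[of "var_tys \<Gamma> ! i" \<Gamma>] by (force simp: wf_env_def)
next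
  case (Con \<Delta> \<Gamma> c T)
  then show ?case by (force simp: wf_env_def)
next
  case (Inst \<Delta> \<Gamma> e K T T')
  then show ?case using proper_ty_subst_ty[of \<Sigma> "[]" K \<Delta> T T'] by (simp add: proper_ty_all)
qed (auto simp: proper_ty_arr proper_ty_all)

text \<open>The typing of \<open>e'\<close> certifies that \<open>T'\<close> is proper. In subject
  reduction \<open>e'\<close> is the redex and \<open>e\<close> its contractum.\<close>

lemma typing_conv:
  "\<Sigma>, \<Delta>, \<Gamma> \<turnstile> e \<Colon> T \<Longrightarrow> T \<leftrightarrow>\<^sub>o\<^sup>* T' \<Longrightarrow> \<Sigma>, \<Delta>, \<Gamma> \<turnstile> e' \<Colon> T' \<Longrightarrow> \<Sigma>, \<Delta>, \<Gamma> \<turnstile> e \<Colon> T'"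
  by (meson typing.Conv typing_regular)

text \<open>Weakening by a type variable, at an arbitrary position so that the induction can pass
  rule \<open>Abs\<close>.\<close>

lemma typing_lift_ev_ty:
  assumes "\<Sigma>, \<Delta>\<^sub>1 @ \<Delta>\<^sub>2, \<Gamma> \<turnstile> e \<Colon> T"
  shows "\<Sigma>, \<Delta>\<^sub>1 @ K # \<Delta>\<^sub>2, map (map_decl_ty (\<lambda>T. lift_ty T (length \<Delta>\<^sub>1))) \<Gamma>
    \<turnstile> lift_ev_ty e (length \<Delta>\<^sub>1) \<Colon> lift_ty T (length \<Delta>\<^sub>1)"
  using assms
proof (induction "\<Delta>\<^sub>1 @ \<Delta>\<^sub>2" \<Gamma> e T arbitrary: \<Delta>\<^sub>1 rule: typing.induct)
  case (Var \<Gamma> i)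
  let ?\<Gamma> = "map (map_decl_ty (\<lambda>T. lift_ty T (length \<Delta>\<^sub>1))) \<Gamma>"
  show ?case using typing.Var[of \<Sigma> "\<Delta>\<^sub>1 @ K # \<Delta>\<^sub>2" ?\<Gamma> i] Var by (simp add: wf_env_lift_ty)
next
  case (Con \<Gamma> c T)
  then show ?case by (auto intro!: typing.Con wf_env_lift_ty ConDecl_map_decl_ty simp del: set_map)
next
  case (Inst \<Gamma> e K' T T')
  have "\<Sigma>, \<Delta>\<^sub>1 @ K # \<Delta>\<^sub>2 \<turnstile>\<^sub>k lift_ty T' (length \<Delta>\<^sub>1) \<Colon> TK K'"
    using Inst by (simp add: kinding_lift_ty_iff)
  from typing.Inst[OF Inst(2)[unfolded lift_ty.simps] this]
  show ?case by (simp add: lift_ty_subst_ty_le)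
next
  case (Abs K' \<Gamma> e T)
  have "\<Sigma>, K' # \<Delta>\<^sub>1 @ K # \<Delta>\<^sub>2, map lift_decl (map (map_decl_ty (\<lambda>T. lift_ty T (length \<Delta>\<^sub>1))) \<Gamma>)
    \<turnstile> lift_ev_ty e (Suc (length \<Delta>\<^sub>1)) \<Colon> lift_ty T (Suc (length \<Delta>\<^sub>1))"
    using Abs(2)[of "K' # \<Delta>\<^sub>1"] unfolding map_lift_decl_lift_ty[symmetric] by simp
  then show ?case by (simp add: typing.Abs)
next
  case (Conv \<Gamma> e T T')
  then show ?case by (metis typing.Conv ty_conv_lift_ty proper_ty_lift_ty_iff)
qed (auto intro: typing.intros)

lemma typing_subst_ev_ty:
  assumes "\<Sigma>, \<Delta>\<^sub>1 @ K # \<Delta>\<^sub>2, \<Gamma> \<turnstile> e \<Colon> T" and "\<Sigma>, \<Delta>\<^sub>1 @ \<Delta>\<^sub>2 \<turnstile>\<^sub>k S \<Colon> TK K"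
  shows "\<Sigma>, \<Delta>\<^sub>1 @ \<Delta>\<^sub>2, map (map_decl_ty (\<lambda>T. subst_ty T S (length \<Delta>\<^sub>1))) \<Gamma>
    \<turnstile> subst_ev_ty e S (length \<Delta>\<^sub>1) \<Colon> subst_ty T S (length \<Delta>\<^sub>1)"
  using assms
proof (induction "\<Delta>\<^sub>1 @ K # \<Delta>\<^sub>2" \<Gamma> e T arbitrary: \<Delta>\<^sub>1 S rule: typing.induct)
  case (Var \<Gamma> i)
  let ?\<Gamma> = "map (map_decl_ty (\<lambda>T. subst_ty T S (length \<Delta>\<^sub>1))) \<Gamma>"
  show ?case using typing.Var[of \<Sigma> "\<Delta>\<^sub>1 @ \<Delta>\<^sub>2" ?\<Gamma> i] Var by (simp add: wf_env_subst_ty)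
next
  case (Con \<Gamma> c T)
  then show ?case
    by (auto intro!: typing.Con wf_env_subst_ty ConDecl_map_decl_ty simp del: set_map)
next
  case (Inst \<Gamma> e K' T T')
  have "\<Sigma>, \<Delta>\<^sub>1 @ \<Delta>\<^sub>2 \<turnstile>\<^sub>k subst_ty T' S (length \<Delta>\<^sub>1) \<Colon> TK K'"
    using Inst by (simp add: kinding_subst_ty)
  from typing.Inst[OF Inst(2)[OF Inst.prems, unfolded subst_ty.simps] this]
  show ?case by (simp add: subst_ty_subst_ty)
next
  case (Abs K' \<Gamma> e T)
  have "\<Sigma>, K' # \<Delta>\<^sub>1 @ \<Delta>\<^sub>2, map lift_decl (map (map_decl_ty (\<lambda>T. subst_ty T S (length \<Delta>\<^sub>1))) \<Gamma>)
    \<turnstile> subst_ev_ty e (lift_ty S 0) (Suc (length \<Delta>\<^sub>1)) \<Colon> subst_ty T (lift_ty S 0) (Suc (length \<Delta>\<^sub>1))"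
    using Abs(2)[of "K' # \<Delta>\<^sub>1" "lift_ty S 0"] Abs.prems
    unfolding map_lift_decl_subst_ty[symmetric] by (simp add: kinding_lift_ty)
  then show ?case by (simp add: typing.Abs)
next
  case (Conv \<Gamma> e T T')
  then show ?case by (metis typing.Conv ty_conv_subst_ty proper_ty_subst_ty)
qed (auto intro: typing.intros)

text \<open>The position is counted in \<open>var_tys\<close>, since constant declarations take up
  no index. \<open>A\<close> varies in the induction because \<open>Abs\<close> lifts it.\<close>

lemma typing_lift_ev:
  assumes "\<Sigma>, \<Delta>, \<Gamma>\<^sub>1 @ \<Gamma>\<^sub>2 \<turnstile> e \<Colon> T" and "proper_ty \<Sigma> \<Delta> A"
  shows "\<Sigma>, \<Delta>, \<Gamma>\<^sub>1 @ VarDecl A # \<Gamma>\<^sub>2 \<turnstile> lift_ev e (length (var_tys \<Gamma>\<^sub>1)) \<Colon> T"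
  using assms
proof (induction \<Delta> "\<Gamma>\<^sub>1 @ \<Gamma>\<^sub>2" e T arbitrary: \<Gamma>\<^sub>1 \<Gamma>\<^sub>2 A rule: typing.induct)
  case (Var \<Delta> i)
  let ?\<Gamma> = "\<Gamma>\<^sub>1 @ VarDecl A # \<Gamma>\<^sub>2" and ?j = "if i < length (var_tys \<Gamma>\<^sub>1) then i else Suc i"
  have "\<Sigma>, \<Delta>, ?\<Gamma> \<turnstile> EVar ?j \<Colon> var_tys ?\<Gamma> ! ?j"
    using Var by (intro typing.Var) auto
  then show ?case by (auto simp: nth_append Suc_diff_le split: if_splits)
next
  case (Con \<Delta> c T)
  then show ?case by (auto intro: typing.Con)
next
  case (Lam \<Delta> T' e T)
  then show ?case using Lam(2)[of "VarDecl T' # \<Gamma>\<^sub>1"] by (auto intro: typing.Lam)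
next
  case (Mu \<Delta> T e)
  then show ?case using Mu(2)[of "VarDecl T # \<Gamma>\<^sub>1"] by (auto intro: typing.Mu)
next
  case (Abs K \<Delta> e T)
  have "proper_ty \<Sigma> (K # \<Delta>) (lift_ty A 0)"
    using Abs.prems proper_ty_lift_ty_iff[of \<Sigma> "[]" K \<Delta> A] by simp
  then show ?case using Abs(2)[of "map lift_decl \<Gamma>\<^sub>1" "map lift_decl \<Gamma>\<^sub>2" "lift_ty A 0"]
    by (auto intro!: typing.Abs simp: lift_decl_eq_map_decl_ty)
next
  case (App \<Delta> e1 T' e2 T)
  show ?case using App(2,4)[OF refl App.prems] by (auto intro: typing.App)
next
  case (Inst \<Delta> e K T T')
  show ?case using Inst(2)[OF refl Inst.prems] Inst(3) by (simp add: typing.Inst)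
qed (auto intro: typing.Conv[rotated])

text \<open>Evidence variables crossed are recorded in \<open>\<Gamma>\<^sub>1\<close>;
  \<open>s\<close> and \<open>A\<close> vary in the induction because binders lift them.\<close>

lemma typing_subst_ev:
  assumes "\<Sigma>, \<Delta>, \<Gamma>\<^sub>1 @ VarDecl A # \<Gamma>\<^sub>2 \<turnstile> e \<Colon> T" and "\<Sigma>, \<Delta>, \<Gamma>\<^sub>1 @ \<Gamma>\<^sub>2 \<turnstile> s \<Colon> A"
  shows "\<Sigma>, \<Delta>, \<Gamma>\<^sub>1 @ \<Gamma>\<^sub>2 \<turnstile> subst_ev e s (length (var_tys \<Gamma>\<^sub>1)) \<Colon> T"
  using assms
proof (induction \<Delta> "\<Gamma>\<^sub>1 @ VarDecl A # \<Gamma>\<^sub>2" e T arbitrary: \<Gamma>\<^sub>1 \<Gamma>\<^sub>2 A s rule: typing.induct)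
  case (Var \<Delta> i)
  let ?\<Gamma> = "\<Gamma>\<^sub>1 @ \<Gamma>\<^sub>2" and ?k = "length (var_tys \<Gamma>\<^sub>1)"
  show ?case
  proof (cases "i = ?k")
    case True
    then show ?thesis using Var by simp
  next
    case False
    let ?j = "if i < ?k then i else i - 1"
    have "\<Sigma>, \<Delta>, ?\<Gamma> \<turnstile> EVar ?j \<Colon> var_tys ?\<Gamma> ! ?j"
      using Var False by (intro typing.Var) auto
    then show ?thesis using False by (auto simp: nth_append nth_Cons' split: if_splits)
  qed
next
  case (Con \<Delta> c T)
  then show ?case by (auto intro: typing.Con)
next
  case (Lam \<Delta> T' e T)
  \<comment> \<open>Weakening \<open>s\<close> by the bound variable requires \<open>T'\<close> to
    be proper; the environment of the premise shows it.\<close>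
  then have "proper_ty \<Sigma> \<Delta> T'" by (auto dest: typing_regular)
  then have "\<Sigma>, \<Delta>, (VarDecl T' # \<Gamma>\<^sub>1) @ \<Gamma>\<^sub>2 \<turnstile> lift_ev s 0 \<Colon> A"
    using typing_lift_ev[of \<Sigma> \<Delta> "[]"] Lam.prems by simp
  then show ?case using Lam(2)[of "VarDecl T' # \<Gamma>\<^sub>1"] by (auto intro: typing.Lam)
next
  case (Mu \<Delta> T e)
  then have "proper_ty \<Sigma> \<Delta> T" by (auto dest: typing_regular)
  then have "\<Sigma>, \<Delta>, (VarDecl T # \<Gamma>\<^sub>1) @ \<Gamma>\<^sub>2 \<turnstile> lift_ev s 0 \<Colon> A"
    using typing_lift_ev[of \<Sigma> \<Delta> "[]"] Mu.prems by simp
  then show ?case using Mu(2)[of "VarDecl T # \<Gamma>\<^sub>1"] by (auto intro: typing.Mu)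
next
  case (Abs K \<Delta> e T)
  have "\<Sigma>, K # \<Delta>, map lift_decl \<Gamma>\<^sub>1 @ map lift_decl \<Gamma>\<^sub>2 \<turnstile> lift_ev_ty s 0 \<Colon> lift_ty A 0"
    using typing_lift_ev_ty[of \<Sigma> "[]" \<Delta> "\<Gamma>\<^sub>1 @ \<Gamma>\<^sub>2" s A K] Abs.prems
    by (simp add: lift_decl_eq_map_decl_ty)
  then show ?case using Abs(2)[of "map lift_decl \<Gamma>\<^sub>1" "lift_ty A 0" "map lift_decl \<Gamma>\<^sub>2"]
    by (auto intro!: typing.Abs simp: lift_decl_eq_map_decl_ty)
next
  case (App \<Delta> e1 T' e2 T)
  show ?case using App(2,4)[OF refl App.prems] by (auto intro: typing.App)
next
  case (Inst \<Delta> e K T T')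
  show ?case using Inst(2)[OF refl Inst.prems] Inst(3) by (simp add: typing.Inst)
qed (auto intro: typing.Conv[rotated])

section \<open>Inversion and subject reduction\<close>

text \<open>\<open>Conv\<close> is the only rule that is not syntax-directed, so a derivation ends
  in one structural rule followed by conversions, which transitivity merges. The other inversions go
  the same way.\<close>

lemma typing_ELamE:
  assumes "\<Sigma>, \<Delta>, \<Gamma> \<turnstile> ELam e \<Colon> T"
  obtains A B where "\<Sigma>, \<Delta>, VarDecl A # \<Gamma> \<turnstile> e \<Colon> B" "TArr A B \<leftrightarrow>\<^sub>o\<^sup>* T"
proof -
  have "\<exists>A B. (\<Sigma>, \<Delta>, VarDecl A # \<Gamma> \<turnstile> e \<Colon> B) \<and> TArr A B \<leftrightarrow>\<^sub>o\<^sup>* T"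
    using assms
    by (induction \<Delta> \<Gamma> "ELam e" T rule: typing.induct) (blast intro: equivclp_refl equivclp_trans)+
  then show ?thesis using that by blast
qed

lemma typing_EMuE:
  assumes "\<Sigma>, \<Delta>, \<Gamma> \<turnstile> EMu e \<Colon> T"
  obtains A where "\<Sigma>, \<Delta>, VarDecl A # \<Gamma> \<turnstile> e \<Colon> A" "A \<leftrightarrow>\<^sub>o\<^sup>* T"
proof -
  have "\<exists>A. (\<Sigma>, \<Delta>, VarDecl A # \<Gamma> \<turnstile> e \<Colon> A) \<and> A \<leftrightarrow>\<^sub>o\<^sup>* T"
    using assms
    by (induction \<Delta> \<Gamma> "EMu e" T rule: typing.induct) (blast intro: equivclp_refl equivclp_trans)+
  then show ?thesis using that by blast
qed

lemma typing_EAppE: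
  assumes "\<Sigma>, \<Delta>, \<Gamma> \<turnstile> EApp e2 e1 \<Colon> T"
  obtains A B where "\<Sigma>, \<Delta>, \<Gamma> \<turnstile> e1 \<Colon> A" "\<Sigma>, \<Delta>, \<Gamma> \<turnstile> e2 \<Colon> TArr A B" "B \<leftrightarrow>\<^sub>o\<^sup>* T"
proof -
  have "\<exists>A B. (\<Sigma>, \<Delta>, \<Gamma> \<turnstile> e1 \<Colon> A) \<and> (\<Sigma>, \<Delta>, \<Gamma> \<turnstile> e2 \<Colon> TArr A B) \<and> B \<leftrightarrow>\<^sub>o\<^sup>* T"
    using assms
    by (induction \<Delta> \<Gamma> "EApp e2 e1" T rule: typing.induct)
      (blast intro: equivclp_refl equivclp_trans)+
  then show ?thesis using that by blast
qed

lemma typing_ETAppE: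
  assumes "\<Sigma>, \<Delta>, \<Gamma> \<turnstile> ETApp e S \<Colon> T"
  obtains K A where "\<Sigma>, \<Delta>, \<Gamma> \<turnstile> e \<Colon> TAll K A" "\<Sigma>, \<Delta> \<turnstile>\<^sub>k S \<Colon> TK K" "subst_ty A S 0 \<leftrightarrow>\<^sub>o\<^sup>* T"
proof -
  have "\<exists>K A. (\<Sigma>, \<Delta>, \<Gamma> \<turnstile> e \<Colon> TAll K A) \<and> (\<Sigma>, \<Delta> \<turnstile>\<^sub>k S \<Colon> TK K) \<and> subst_ty A S 0 \<leftrightarrow>\<^sub>o\<^sup>* T"
    using assms
    by (induction \<Delta> \<Gamma> "ETApp e S" T rule: typing.induct)
      (blast intro: equivclp_refl equivclp_trans)+
  then show ?thesis using that by blast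
qed

lemma typing_ETLamE:
  assumes "\<Sigma>, \<Delta>, \<Gamma> \<turnstile> ETLam e \<Colon> T"
  obtains K A where "\<Sigma>, K # \<Delta>, map lift_decl \<Gamma> \<turnstile> e \<Colon> A" "TAll K A \<leftrightarrow>\<^sub>o\<^sup>* T"
proof -
  have "\<exists>K A. (\<Sigma>, K # \<Delta>, map lift_decl \<Gamma> \<turnstile> e \<Colon> A) \<and> TAll K A \<leftrightarrow>\<^sub>o\<^sup>* T"
    using assms
    by (induction \<Delta> \<Gamma> "ETLam e" T rule: typing.induct) (blast intro: equivclp_refl equivclp_trans)+
  then show ?thesis using that by blast
qed

text \<open>The assumption on \<open>e\<close> and \<open>e'\<close> ranges over all environments
  and types, because the context may bind variables and fixes the type at the hole only up to
  inversion.\<close>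

lemma typing_plugC:
  assumes "\<Sigma>, \<Delta>, \<Gamma> \<turnstile> plugC C e \<Colon> T"
    and "\<And>\<Delta> \<Gamma> T. \<Sigma>, \<Delta>, \<Gamma> \<turnstile> e \<Colon> T \<Longrightarrow> \<Sigma>, \<Delta>, \<Gamma> \<turnstile> e' \<Colon> T"
  shows "\<Sigma>, \<Delta>, \<Gamma> \<turnstile> plugC C e' \<Colon> T"
  using assms(1)
proof (induction C arbitrary: \<Delta> \<Gamma> T)
  case CHole
  then show ?case using assms(2) by simp
next
  case (CAppL C e1)
  \<comment> \<open>Inversion recovers the type only up to conversion; regularity allows the final
    \<open>Conv\<close> back to it.\<close>
  show ?case using typing_regular[OF CAppL.prems] CAppL.prems
    by (auto elim!: typing_EAppE intro: CAppL.IH typing.App typing.Conv[rotated])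
next
  case (CTApp C S)
  show ?case using typing_regular[OF CTApp.prems] CTApp.prems
    by (auto elim!: typing_ETAppE intro: CTApp.IH typing.Inst typing.Conv[rotated])
next
  case (CLam C)
  show ?case using typing_regular[OF CLam.prems] CLam.prems
    by (auto elim!: typing_ELamE intro: CLam.IH typing.Lam typing.Conv[rotated])
next
  case (CTLam C)
  show ?case using typing_regular[OF CTLam.prems] CTLam.prems
    by (auto elim!: typing_ETLamE intro: CTLam.IH typing.Abs typing.Conv[rotated])
next
  case (CAppR e2 C)
  show ?case using typing_regular[OF CAppR.prems] CAppR.prems
    by (auto elim!: typing_EAppE intro: CAppR.IH typing.App typing.Conv[rotated])
next
  case (CMu C)
  show ?case using typing_regular[OF CMu.prems] CMu.prems
    by (auto elim!: typing_EMuE intro: CMu.IH typing.Mu typing.Conv[rotated])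
qed

text \<open>Head contexts are particular evidence contexts, so one replacement lemma serves all
  three reductions.\<close>

lemma plugH_eq_plugC: "\<exists>C. \<forall>e. plugH H e = plugC C e"
proof (induction H)
  case HHole
  show ?case by (metis plugC.simps(1) plugH.simps(1))
next
  case (HApp H e)
  then show ?case by (metis plugC.simps(2) plugH.simps(2))
next
  case (HLam H)
  then show ?case by (metis plugC.simps(4) plugH.simps(3))
next
  case (HTLam H)
  then show ?case by (metis plugC.simps(5) plugH.simps(4))
qed

section \<open>Type preservation for each kind of redex\<close>

lemma typing_mu:
  assumes "\<Sigma>, \<Delta>, \<Gamma> \<turnstile> EMu e \<Colon> T"
  shows "\<Sigma>, \<Delta>, \<Gamma> \<turnstile> subst_ev e (EMu e) 0 \<Colon> T"
proof -
  from assms obtain A where A: "\<Sigma>, \<Delta>, VarDecl A # \<Gamma> \<turnstile> e \<Colon> A" "A \<leftrightarrow>\<^sub>o\<^sup>* T"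
    by (rule typing_EMuE)
  \<comment> \<open>Rule \<open>Mu\<close> gives \<open>EMu e\<close> the very type \<open>A\<close>
    of the variable it replaces.\<close>
  have "\<Sigma>, \<Delta>, \<Gamma> \<turnstile> subst_ev e (EMu e) 0 \<Colon> A"
    using typing_subst_ev[of \<Sigma> \<Delta> "[]" A \<Gamma> e A "EMu e"] A(1) by (simp add: typing.Mu)
  then show ?thesis using A(2) assms by (rule typing_conv)
qed

lemma typing_beta:
  assumes "\<Sigma>, \<Delta>, \<Gamma> \<turnstile> EApp (ELam e) s \<Colon> T"
  shows "\<Sigma>, \<Delta>, \<Gamma> \<turnstile> subst_ev e s 0 \<Colon> T"
proof -
  from assms obtain A B where
    s: "\<Sigma>, \<Delta>, \<Gamma> \<turnstile> s \<Colon> A" and lam: "\<Sigma>, \<Delta>, \<Gamma> \<turnstile> ELam e \<Colon> TArr A B" and B: "B \<leftrightarrow>\<^sub>o\<^sup>* T"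
    by (rule typing_EAppE)
  from lam obtain A' B' where
    e: "\<Sigma>, \<Delta>, VarDecl A' # \<Gamma> \<turnstile> e \<Colon> B'" and conv: "TArr A' B' \<leftrightarrow>\<^sub>o\<^sup>* TArr A B"
    by (rule typing_ELamE)
  \<comment> \<open>The abstraction was typed with domain \<open>A'\<close>, the argument with
    \<open>A\<close>; injectivity of implication moves the argument to \<open>A'\<close>.\<close>
  have "proper_ty \<Sigma> \<Delta> A'" using typing_regular[OF e] by simp
  with s ty_conv_arrD(1)[OF conv] have "\<Sigma>, \<Delta>, \<Gamma> \<turnstile> s \<Colon> A'"
    by (blast intro: typing.Conv equivclp_sym)
  with e have "\<Sigma>, \<Delta>, \<Gamma> \<turnstile> subst_ev e s 0 \<Colon> B'"
    using typing_subst_ev[of \<Sigma> \<Delta> "[]" A' \<Gamma> e B' s] by simp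
  moreover have "B' \<leftrightarrow>\<^sub>o\<^sup>* T" using ty_conv_arrD(2)[OF conv] B by (rule equivclp_trans)
  ultimately show ?thesis using assms by (rule typing_conv)
qed

lemma typing_tau:
  assumes "\<Sigma>, \<Delta>, \<Gamma> \<turnstile> ETApp (ETLam e) S \<Colon> T"
  shows "\<Sigma>, \<Delta>, \<Gamma> \<turnstile> subst_ev_ty e S 0 \<Colon> T"
proof -
  from assms obtain K A where lam: "\<Sigma>, \<Delta>, \<Gamma> \<turnstile> ETLam e \<Colon> TAll K A"
    and S: "\<Sigma>, \<Delta> \<turnstile>\<^sub>k S \<Colon> TK K" and A: "subst_ty A S 0 \<leftrightarrow>\<^sub>o\<^sup>* T"
    by (rule typing_ETAppE)
  from lam obtain K' B where
    e: "\<Sigma>, K' # \<Delta>, map lift_decl \<Gamma> \<turnstile> e \<Colon> B" and conv: "TAll K' B \<leftrightarrow>\<^sub>o\<^sup>* TAll K A"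
    by (rule typing_ETLamE)
  \<comment> \<open>Convertible quantifiers have equal kinds, so \<open>S\<close> fits the
    abstraction. Keeping the two maps separate lets \<open>map_subst_ty_lift_decl\<close> restore
    \<open>\<Gamma>\<close>.\<close>
  have "\<Sigma>, \<Delta>, \<Gamma> \<turnstile> subst_ev_ty e S 0 \<Colon> subst_ty B S 0"
    using typing_subst_ev_ty[of \<Sigma> "[]" K' \<Delta> "map lift_decl \<Gamma>" e B S] e S ty_conv_allD(1)[OF conv]
    by (simp del: map_map)
  moreover have "subst_ty B S 0 \<leftrightarrow>\<^sub>o\<^sup>* T"
    using ty_conv_subst_ty[OF ty_conv_allD(2)[OF conv]] A by (rule equivclp_trans)
  ultimately show ?thesis using assms by (rule typing_conv)
qed

lemma typing_o:
  assumes "\<Sigma>, \<Delta>, \<Gamma> \<turnstile> ETApp e S \<Colon> T" and "S \<rightarrow>\<^sub>o S'"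
  shows "\<Sigma>, \<Delta>, \<Gamma> \<turnstile> ETApp e S' \<Colon> T"
proof -
  from assms(1) obtain K A where e: "\<Sigma>, \<Delta>, \<Gamma> \<turnstile> e \<Colon> TAll K A"
    and S: "\<Sigma>, \<Delta> \<turnstile>\<^sub>k S \<Colon> TK K" and A: "subst_ty A S 0 \<leftrightarrow>\<^sub>o\<^sup>* T"
    by (rule typing_ETAppE)
  have "\<Sigma>, \<Delta>, \<Gamma> \<turnstile> ETApp e S' \<Colon> subst_ty A S' 0"
    using e kinding_ty_red[OF assms(2) S] by (rule typing.Inst)
  moreover have "subst_ty A S' 0 \<leftrightarrow>\<^sub>o\<^sup>* T"
    using equivclp_sym[OF ty_conv_subst_ty_arg[OF assms(2)]] A by (rule equivclp_trans)
  ultimately show ?thesis using assms(1) by (rule typing_conv)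
qed

theorem theorem14:
  fixes \<Sigma> :: "'f \<Rightarrow> tkind" and \<Delta> :: "tkind list" and \<Gamma> :: "('f, 'c) env"
    and e e' :: "('f, 'c) evid" and T :: "'f ty"
  assumes "\<Sigma>, \<Delta>, \<Gamma> \<turnstile> e \<Colon> T"
    and "e \<leadsto>\<^sub>h\<^sub>\<tau>\<^sub>o e'"
  shows "\<Sigma>, \<Delta>, \<Gamma> \<turnstile> e' \<Colon> T"
proof -
  \<comment> \<open>Replacement in a head context, so that the redex lemmas apply to head steps
    too.\<close>
  have plugH: "\<Sigma>, \<Delta>, \<Gamma> \<turnstile> plugH H s' \<Colon> T"
    if "\<Sigma>, \<Delta>, \<Gamma> \<turnstile> plugH H s \<Colon> T"
      and "\<And>\<Delta> \<Gamma> T. \<Sigma>, \<Delta>, \<Gamma> \<turnstile> s \<Colon> T \<Longrightarrow> \<Sigma>, \<Delta>, \<Gamma> \<turnstile> s' \<Colon> T"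
    for H and s s' :: "('f, 'c) evid"
    using that plugH_eq_plugC[of H] typing_plugC by metis
  from assms(2) consider "e \<leadsto>\<^sub>h e'" | "e \<leadsto>\<^sub>\<tau> e'" | "e \<leadsto>\<^sub>o e'"
    by (auto simp: red_hto_def)
  then show ?thesis
  proof cases
    case 1
    then show ?thesis using assms(1)
      by cases (auto elim: plugH intro: typing_mu typing_beta)
  next
    case 2
    then show ?thesis using assms(1)
      by cases (auto elim: typing_plugC intro: typing_tau)
  next
    case 3
    then show ?thesis using assms(1)
      by cases (auto elim: typing_plugC intro: typing_o)
  qed
qed

end
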